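(* Let $\mathscr{H}$ be a nonzero complex Hilbert space, let $T,S\in\mathbb{B}(\mathscr{H})$ and let $\varepsilon\in[0,1)$. Then $T\perp^{\varepsilon}_{\omega}S$ if and only if for every $\theta\in[0,2\pi)$ there exists a sequence $\{x^{\theta}_n\}_{n\in\mathbb{N}}$ of unit vectors in $\mathscr{H}$ such that the following two conditions hold (the limits being understood to exist): (i) $\displaystyle\lim_{n\to\infty}|\langle Tx^{\theta}_n,x^{\theta}_n\rangle|=\omega(T)$; (ii) $\displaystyle\lim_{n\to\infty}\mathrm{Re}\{e^{-i\theta}\langle Tx^{\theta}_n,x^{\theta}_n\rangle\overline{\langle Sx^{\theta}_n,x^{\theta}_n\rangle}\}\geq-\varepsilon\,\omega(T)\,\omega(S)$.
   Context: $\mathbb{B}(\mathscr{H})$ is the algebra of all bounded linear operators on $\mathscr{H}$, whose inner product $\langle\cdot,\cdot\rangle$ is linear in the first variable. The numerical radius of $T\in\mathbb{B}(\mathscr{H})$ is $\omega(T)=\sup\{|\langle Tx,x\rangle|: x\in\mathscr{H},\ \|x\|=1\}$. The relation $T\perp^{\varepsilon}_{\omega}S$ ($T$ is approximate numerical radius orthogonal to $S$) means $$\omega^2(T+\lambda S)\geq\omega^2(T)-2\varepsilon\,\omega(T)\,\omega(\lambda S)\quad\text{for all }\lambda\in\mathbb{C},$$ where $\omega^2(A)=(\omega(A))^2$. *)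

theory Defs
  imports "HOL-Analysis.Analysis"
begin

text \<open>
  Complex Hilbert spaces as a type class. The inner product is linear in the \<^emph>\<open>first\<close> variable
  and induces the norm, and hence the metric and topology, of \<^class>\<open>real_normed_vector\<close>.
\<close>

class complex_inner = real_normed_vector +
  fixes scaleC :: "complex \<Rightarrow> 'a \<Rightarrow> 'a" (infixr "*\<^sub>C" 75)
    and cinner :: "'a \<Rightarrow> 'a \<Rightarrow> complex"
  assumes scaleC_add_right: "c *\<^sub>C (x + y) = c *\<^sub>C x + c *\<^sub>C y"
    and scaleC_add_left: "(c + d) *\<^sub>C x = c *\<^sub>C x + d *\<^sub>C x"
    and scaleC_scaleC: "c *\<^sub>C d *\<^sub>C x = (c * d) *\<^sub>C x"
    and scaleR_scaleC: "r *\<^sub>R x = complex_of_real r *\<^sub>C x"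
    and cinner_commute: "cinner x y = cnj (cinner y x)"
    and cinner_add_left: "cinner (x + y) z = cinner x z + cinner y z"
    and cinner_scaleC_left: "cinner (c *\<^sub>C x) y = c * cinner x y"
    and cinner_ge_zero: "0 \<le> Re (cinner x x)"
    and cinner_eq_zero_iff: "cinner x x = 0 \<longleftrightarrow> x = 0"
    and norm_eq_sqrt_cinner: "norm x = sqrt (Re (cinner x x))"

class complex_hilbert_space = complex_inner + complete_space

instantiation complex :: complex_hilbert_space
begin

definition scaleC_complex :: "complex \<Rightarrow> complex \<Rightarrow> complex"
  where "scaleC_complex c x = c * x"

definition cinner_complex :: "complex \<Rightarrow> complex \<Rightarrow> complex"
  where "cinner_complex x y = x * cnj y"

instance
  by standard
    (auto simp: scaleC_complex_def cinner_complex_def algebra_simps scaleR_conv_of_real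
      complex_eq_iff cmod_def power2_eq_square)

end

locale bounded_clinear = bounded_linear T
  for T :: "'a::complex_inner \<Rightarrow> 'b::complex_inner" +
  assumes scaleC: "T (c *\<^sub>C x) = c *\<^sub>C T x"

text \<open>
  The supremum is taken in the reals, so it is meaningful only if the set is nonempty and bounded
  above, as it is for bounded operators on a nonzero space.
\<close>

definition numerical_radius :: "('a::complex_inner \<Rightarrow> 'a) \<Rightarrow> real"
  where "numerical_radius T = Sup {cmod (cinner (T x) x) | x. norm x = 1}"

definition approx_numerical_radius_orthogonal ::
    "real \<Rightarrow> ('a::complex_inner \<Rightarrow> 'a) \<Rightarrow> ('a \<Rightarrow> 'a) \<Rightarrow> bool"
  where "approx_numerical_radius_orthogonal \<epsilon> T S \<longleftrightarrow>
    (\<forall>c::complex.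
      (numerical_radius (\<lambda>x. T x + c *\<^sub>C S x))\<^sup>2
        \<ge> (numerical_radius T)\<^sup>2
            - 2 * \<epsilon> * numerical_radius T * numerical_radius (\<lambda>x. c *\<^sub>C S x))"

end

theory Submission
  imports Defs
begin

text \<open>
  Everything rests on one expansion. For a unit vector \<open>x\<close> put \<open>a = \<langle>Tx, x\<rangle>\<close> and
  \<open>b = \<langle>Sx, x\<rangle>\<close>; then for real \<open>r \<ge> 0\<close>
  \[ |a + r e^{i\theta} b|^2 = |a|^2 + 2 r\, Re (e^{-i\theta} a \bar b) + r^2 |b|^2 . \]
  The left side is at most \<open>\<omega>\<^sup>2(T + r e\<^sup>i\<^sup>\<theta> S)\<close>, with near equality for suitable \<open>x\<close>.

  If a sequence as in the theorem exists for the argument \<open>\<theta>\<close> of \<open>c = r e\<^sup>i\<^sup>\<theta>\<close>, drop the last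
  term, which is nonnegative, and pass to the limit along the sequence: this bounds
  \<open>\<omega>\<^sup>2(T + cS)\<close> below by \<open>\<omega>\<^sup>2(T) - 2 \<epsilon> r \<omega>(T) \<omega>(S)\<close>.

  Conversely, fix \<open>\<theta>\<close> and choose for each small \<open>r > 0\<close> a unit vector at which \<open>T + r e\<^sup>i\<^sup>\<theta> S\<close>
  attains \<open>\<omega>\<^sup>2\<close> up to an error of \<open>r\<^sup>2\<close>. An error of second order is what is needed, because
  the orthogonality inequality is then compared with the expansion at first order in \<open>r\<close>: since
  \<open>|a| \<le> \<omega>(T)\<close>, dividing by \<open>2r\<close> leaves the lower bound \<open>-\<epsilon> \<omega>(T) \<omega>(S) - O(r)\<close> for the real
  part, while at order zero it forces \<open>|a| \<rightarrow> \<omega>(T)\<close>. The real parts stay bounded, so along a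
  subsequence of \<open>r = 1, 1/2, 1/3, \<dots>\<close> they converge (\<open>near_maximizer\<close> and
  \<open>sequence_if_orthogonal\<close>).
\<close>

section \<open>Complex inner products\<close>

lemma cinner_add_right:
  "cinner x (y + z) = cinner x y + cinner x (z::'a::complex_inner)"
  by (metis cinner_add_left cinner_commute complex_cnj_add)

lemma cinner_scaleC_right:
  "cinner x (c *\<^sub>C y) = cnj c * cinner x (y::'a::complex_inner)"
  by (metis cinner_commute cinner_scaleC_left complex_cnj_mult)

lemma norm_sq_eq_cinner: "(norm x)\<^sup>2 = Re (cinner x (x::'a::complex_inner))"
  by (simp add: norm_eq_sqrt_cinner cinner_ge_zero)

lemma norm_scaleC: "norm (c *\<^sub>C x) = cmod c * norm (x::'a::complex_inner)"
proof -
  have "cinner (c *\<^sub>C x) (c *\<^sub>C x) = complex_of_real ((cmod c)\<^sup>2) * cinner x x"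
    by (simp only: cinner_scaleC_left cinner_scaleC_right complex_norm_square mult_ac)
  then have "(norm (c *\<^sub>C x))\<^sup>2 = (cmod c * norm x)\<^sup>2"
    by (simp add: norm_sq_eq_cinner power_mult_distrib)
  then show ?thesis by (simp add: power2_eq_iff_nonneg)
qed

text \<open>
  The norm is assumed to satisfy the triangle inequality, so Cauchy-Schwarz comes for free:
  expand \<open>\<parallel>x + y\<parallel>\<^sup>2 \<le> (\<parallel>x\<parallel> + \<parallel>y\<parallel>)\<^sup>2\<close>. Rotating \<open>x\<close> by a phase turns the real part into the modulus.
\<close>

lemma Re_cinner_le: "Re (cinner x y) \<le> norm x * norm (y::'a::complex_inner)"
proof -
  have "Re (cinner y x) = Re (cinner x y)"
    by (subst cinner_commute) simp
  then have "(norm (x + y))\<^sup>2 = (norm x)\<^sup>2 + 2 * Re (cinner x y) + (norm y)\<^sup>2"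
    by (simp add: norm_sq_eq_cinner cinner_add_left cinner_add_right)
  moreover have "(norm (x + y))\<^sup>2 \<le> (norm x + norm y)\<^sup>2"
    by (intro power_mono norm_triangle_ineq norm_ge_zero)
  ultimately show ?thesis by (simp add: power2_sum)
qed

lemma cmod_cinner_le: "cmod (cinner x y) \<le> norm x * norm (y::'a::complex_inner)"
proof -
  define u where "u = cnj (cis (Arg (cinner x y)))"
  have u: "cmod u = 1" by (simp add: u_def)
  have "u * cinner x y = u * (complex_of_real (cmod (cinner x y)) * cnj u)"
    by (metis complex_cnj_cnj rcis_cmod_Arg rcis_def u_def)
  also have "\<dots> = complex_of_real (cmod (cinner x y)) * (u * cnj u)"
    by simp
  also have "\<dots> = complex_of_real (cmod (cinner x y))"
    using u by (simp flip: complex_norm_square)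
  finally have "cmod (cinner x y) = Re (cinner (u *\<^sub>C x) y)"
    by (simp add: cinner_scaleC_left)
  then show ?thesis
    using Re_cinner_le[of "u *\<^sub>C x" y] u by (simp add: norm_scaleC)
qed

lemma ex_unit_vector:
  assumes "\<exists>x::'a::real_normed_vector. x \<noteq> 0"
  shows "\<exists>x::'a. norm x = 1"
proof -
  obtain x :: 'a where "x \<noteq> 0" using assms by blast
  then have "norm (sgn x) = 1" by (simp add: norm_sgn)
  then show ?thesis ..
qed

lemma bounded_clinear_add_scaleC:
  fixes T S :: "'a::complex_inner \<Rightarrow> 'b::complex_inner"
  assumes T: "bounded_clinear T" and S: "bounded_clinear S"
  shows "bounded_clinear (\<lambda>x. T x + c *\<^sub>C S x)"
proof -
  interpret T: bounded_clinear T by fact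
  interpret S: bounded_clinear S by fact
  have "bounded_linear (\<lambda>y::'b. c *\<^sub>C y)"
    by (rule bounded_linear_intro[where K = "cmod c"])
      (simp_all add: scaleC_add_right scaleR_scaleC scaleC_scaleC norm_scaleC mult.commute)
  then have "bounded_linear (\<lambda>x. T x + c *\<^sub>C S x)"
    by (intro bounded_linear_add T.bounded_linear_axioms
        bounded_linear_compose[of "\<lambda>y. c *\<^sub>C y" S] S.bounded_linear_axioms)
  then show ?thesis
    by (intro bounded_clinear.intro bounded_clinear_axioms.intro)
      (simp_all add: T.scaleC S.scaleC scaleC_add_right scaleC_scaleC mult.commute)
qed

section \<open>The numerical radius\<close>

lemma numerical_values_bdd_above:
  fixes T :: "'a::complex_inner \<Rightarrow> 'a"
  assumes "bounded_clinear T"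
  shows "bdd_above {cmod (cinner (T x) x) | x. norm x = 1}"
proof -
  interpret bounded_clinear T by fact
  have "cmod (cinner (T x) x) \<le> onorm T" if "norm x = 1" for x
    using cmod_cinner_le[of "T x" x] onorm[OF bounded_linear_axioms, of x] that by simp
  then show ?thesis by (auto intro!: bdd_aboveI)
qed

lemma cmod_cinner_le_numerical_radius:
  fixes T :: "'a::complex_inner \<Rightarrow> 'a"
  assumes "bounded_clinear T" and "norm x = 1"
  shows "cmod (cinner (T x) x) \<le> numerical_radius T"
  unfolding numerical_radius_def
  by (rule cSup_upper) (use assms numerical_values_bdd_above in auto)

lemma numerical_radius_le:
  fixes T :: "'a::complex_inner \<Rightarrow> 'a"
  assumes "\<exists>x::'a. norm x = 1"
    and "\<And>x. norm x = 1 \<Longrightarrow> cmod (cinner (T x) x) \<le> B"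
  shows "numerical_radius T \<le> B"
  unfolding numerical_radius_def
  by (rule cSup_least) (use assms in auto)

lemma numerical_radius_nonneg:
  fixes T :: "'a::complex_inner \<Rightarrow> 'a"
  assumes "\<exists>x::'a. norm x = 1" and "bounded_clinear T"
  shows "0 \<le> numerical_radius T"
  by (meson assms cmod_cinner_le_numerical_radius norm_ge_zero order_trans)

lemma ex_cmod_cinner_sq_gt:
  fixes T :: "'a::complex_inner \<Rightarrow> 'a"
  assumes unit: "\<exists>x::'a. norm x = 1" and T: "bounded_clinear T" and "d > 0"
  shows "\<exists>x. norm x = 1 \<and> (numerical_radius T)\<^sup>2 - d < (cmod (cinner (T x) x))\<^sup>2"
proof (rule ccontr)
  assume "\<not> ?thesis"
  then have le: "(cmod (cinner (T x) x))\<^sup>2 \<le> (numerical_radius T)\<^sup>2 - d" if "norm x = 1" for x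
    using that by (meson not_le)
  have "numerical_radius T \<le> sqrt ((numerical_radius T)\<^sup>2 - d)"
    by (rule numerical_radius_le[OF unit]) (simp add: le real_le_rsqrt)
  moreover have "0 \<le> (numerical_radius T)\<^sup>2 - d"
    using unit le by (meson order_trans zero_le_power2)
  ultimately have "(numerical_radius T)\<^sup>2 \<le> (numerical_radius T)\<^sup>2 - d"
    using numerical_radius_nonneg[OF unit T] by (metis power_mono real_sqrt_pow2)
  with \<open>d > 0\<close> show False by simp
qed

lemma numerical_radius_scaleC:
  fixes S :: "'a::complex_inner \<Rightarrow> 'a"
  assumes unit: "\<exists>x::'a. norm x = 1" and S: "bounded_clinear S"
  shows "numerical_radius (\<lambda>x. c *\<^sub>C S x) = cmod c * numerical_radius S"
proof -
  let ?V = "{cmod (cinner (S x) x) | x. norm x = 1}"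
  have "{cmod (cinner (c *\<^sub>C S x) x) | x. norm x = 1} = (\<lambda>t. cmod c * t) ` ?V"
    by (auto simp: cinner_scaleC_left norm_mult)
  moreover have "cmod c * Sup ?V = (SUP t\<in>?V. cmod c * t)"
    using unit numerical_values_bdd_above[OF S]
    by (intro continuous_at_Sup_mono) (auto intro!: monoI mult_left_mono continuous_intros)
  ultimately show ?thesis by (simp add: numerical_radius_def)
qed

section \<open>Approximate orthogonality and sequences of unit vectors\<close>

text \<open>
  The factor \<open>exp (- (\<i> * \<theta>))\<close> in the cross term is the conjugate of the phase of the coefficient of
  \<open>b\<close>.
\<close>

lemma cmod_add_phase_sq:
  "(cmod (a + complex_of_real r * exp (\<i> * complex_of_real \<theta>) * b))\<^sup>2 =
    (cmod a)\<^sup>2 + 2 * r * Re (exp (- (\<i> * complex_of_real \<theta>)) * a * cnj b) + r\<^sup>2 * (cmod b)\<^sup>2"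
proof -
  have "(cmod (a + complex_of_real r * u * b))\<^sup>2
      = (cmod a)\<^sup>2 + 2 * r * Re (cnj u * a * cnj b) + r\<^sup>2 * (cmod (u * b))\<^sup>2" for u
    unfolding cmod_power2 by (simp add: power2_eq_square algebra_simps)
  from this[of "exp (\<i> * complex_of_real \<theta>)"] show ?thesis
    by (simp add: norm_mult exp_cnj del: times_complex.sel)
qed

text \<open>
  The limit is taken inside \<open>\<omega>\<^sup>2(T + r e\<^sup>i\<^sup>\<theta> S) \<ge> |a\<^sub>n|\<^sup>2 + 2 r Re (e\<^sup>-\<^sup>i\<^sup>\<theta> a\<^sub>n cnj b\<^sub>n)\<close>, where \<open>a\<^sub>n\<close> and \<open>b\<^sub>n\<close>
  are the values of the two quadratic forms at \<open>x\<^sub>n\<close>.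
\<close>

lemma numerical_radius_sq_ge_limit:
  fixes T S :: "'a::complex_inner \<Rightarrow> 'a" and x :: "nat \<Rightarrow> 'a"
  assumes T: "bounded_clinear T" and S: "bounded_clinear S"
    and x: "\<And>n. norm (x n) = 1"
    and lim_T: "(\<lambda>n. cmod (cinner (T (x n)) (x n))) \<longlonglongrightarrow> t"
    and lim_l: "(\<lambda>n. Re (exp (- (\<i> * complex_of_real \<theta>)) * cinner (T (x n)) (x n)
                     * cnj (cinner (S (x n)) (x n)))) \<longlonglongrightarrow> l"
  shows "t\<^sup>2 + 2 * r * l
    \<le> (numerical_radius (\<lambda>x. T x + (complex_of_real r * exp (\<i> * complex_of_real \<theta>)) *\<^sub>C S x))\<^sup>2"
    (is "_ \<le> (numerical_radius ?A)\<^sup>2")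
proof -
  let ?a = "\<lambda>n. cinner (T (x n)) (x n)" and ?b = "\<lambda>n. cinner (S (x n)) (x n)"
  let ?re = "\<lambda>n. Re (exp (- (\<i> * complex_of_real \<theta>)) * ?a n * cnj (?b n))"
  have "(cmod (?a n))\<^sup>2 + 2 * r * ?re n \<le> (numerical_radius ?A)\<^sup>2" for n
  proof -
    have "(cmod (?a n))\<^sup>2 + 2 * r * ?re n \<le> (cmod (cinner (?A (x n)) (x n)))\<^sup>2"
      using cmod_add_phase_sq[of "?a n" r \<theta> "?b n"]
      by (simp add: cinner_add_left cinner_scaleC_left)
    also have "\<dots> \<le> (numerical_radius ?A)\<^sup>2"
      by (intro power_mono norm_ge_zero cmod_cinner_le_numerical_radius
          bounded_clinear_add_scaleC T S x)
    finally show ?thesis .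
  qed
  moreover have "(\<lambda>n. (cmod (?a n))\<^sup>2 + 2 * r * ?re n) \<longlonglongrightarrow> t\<^sup>2 + 2 * r * l"
    by (intro tendsto_intros lim_T lim_l)
  ultimately show ?thesis
    by (intro LIMSEQ_le_const2) auto
qed

text \<open>
  The vector \<open>x\<close> is one at which the quadratic form of \<open>T + r e\<^sup>i\<^sup>\<theta> S\<close> has squared modulus within
  \<open>r\<^sup>2\<close> of \<open>\<omega>\<^sup>2(T + r e\<^sup>i\<^sup>\<theta> S)\<close>. The tolerance \<open>r\<^sup>2\<close> is of the same order as the term \<open>r\<^sup>2 |b|\<^sup>2\<close> of the expansion, so both contribute only \<open>O(r)\<close> to the
  bound on the real part.
\<close>

lemma near_maximizer:
  fixes T S :: "'a::complex_inner \<Rightarrow> 'a"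
  assumes unit: "\<exists>x::'a. norm x = 1"
    and T: "bounded_clinear T" and S: "bounded_clinear S"
    and orth: "approx_numerical_radius_orthogonal \<epsilon> T S"
    and "r > 0"
  shows "\<exists>x. norm x = 1
    \<and> Re (exp (- (\<i> * complex_of_real \<theta>)) * cinner (T x) x * cnj (cinner (S x) x))
        \<ge> - \<epsilon> * numerical_radius T * numerical_radius S - r * (1 + (numerical_radius S)\<^sup>2) / 2
    \<and> (cmod (cinner (T x) x))\<^sup>2 \<ge> (numerical_radius T)\<^sup>2
        - r * (2 * \<epsilon> * numerical_radius T * numerical_radius S
               + r * (1 + (numerical_radius S)\<^sup>2) + 2 * numerical_radius T * numerical_radius S)"
proof -
  let ?t = "numerical_radius T" and ?s = "numerical_radius S"
  let ?c = "complex_of_real r * exp (\<i> * complex_of_real \<theta>)"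
  let ?A = "\<lambda>x. T x + ?c *\<^sub>C S x"
  have c: "cmod ?c = r" using \<open>r > 0\<close> by (simp add: norm_mult)
  obtain x where x: "norm x = 1"
    and gt: "(numerical_radius ?A)\<^sup>2 - r\<^sup>2 < (cmod (cinner (?A x) x))\<^sup>2"
    using ex_cmod_cinner_sq_gt[OF unit bounded_clinear_add_scaleC[OF T S, of ?c], of "r\<^sup>2"] \<open>r > 0\<close>
    by auto
  let ?a = "cinner (T x) x" and ?b = "cinner (S x) x"
  define p where "p = Re (exp (- (\<i> * complex_of_real \<theta>)) * ?a * cnj ?b)"
  have a: "cmod ?a \<le> ?t" and b: "cmod ?b \<le> ?s"
    using cmod_cinner_le_numerical_radius T S x by blast+
  have a2: "(cmod ?a)\<^sup>2 \<le> ?t\<^sup>2" and b2: "(cmod ?b)\<^sup>2 \<le> ?s\<^sup>2"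
    using a b by (auto intro: power_mono)
  have "p \<le> cmod (exp (- (\<i> * complex_of_real \<theta>)) * ?a * cnj ?b)"
    unfolding p_def by (rule complex_Re_le_cmod)
  also have "\<dots> = cmod ?a * cmod ?b"
    by (simp add: norm_mult)
  also have "\<dots> \<le> ?t * ?s"
    using a b by (intro mult_mono) (auto intro: order_trans[OF norm_ge_zero])
  finally have p_le: "p \<le> ?t * ?s" .
  have "?t\<^sup>2 - 2 * \<epsilon> * ?t * (r * ?s) \<le> (numerical_radius ?A)\<^sup>2"
    using orth numerical_radius_scaleC[OF unit S, of ?c] c
    unfolding approx_numerical_radius_orthogonal_def by metis
  also have "\<dots> \<le> (cmod (cinner (?A x) x))\<^sup>2 + r\<^sup>2"
    using gt by simp
  also have "\<dots> = (cmod ?a)\<^sup>2 + 2 * r * p + r\<^sup>2 * (cmod ?b)\<^sup>2 + r\<^sup>2"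
    using cmod_add_phase_sq[of ?a r \<theta> ?b]
    by (simp add: p_def cinner_add_left cinner_scaleC_left)
  also have "\<dots> \<le> (cmod ?a)\<^sup>2 + 2 * r * p + r\<^sup>2 * ?s\<^sup>2 + r\<^sup>2"
    using b2 by (simp add: mult_left_mono)
  finally have main: "?t\<^sup>2 - 2 * \<epsilon> * ?t * (r * ?s)
      \<le> (cmod ?a)\<^sup>2 + 2 * r * p + r\<^sup>2 * ?s\<^sup>2 + r\<^sup>2" .
  have "0 \<le> r * (2 * p + 2 * \<epsilon> * ?t * ?s + r * (1 + ?s\<^sup>2))"
    using main a2 by (simp add: algebra_simps power2_eq_square)
  then have "0 \<le> 2 * p + 2 * \<epsilon> * ?t * ?s + r * (1 + ?s\<^sup>2)"
    using \<open>r > 0\<close> by (simp add: zero_le_mult_iff)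
  then have "p \<ge> - \<epsilon> * ?t * ?s - r * (1 + ?s\<^sup>2) / 2"
    by (simp add: field_simps)
  moreover have "r * p \<le> r * (?t * ?s)"
    using p_le \<open>r > 0\<close> by simp
  then have "(cmod ?a)\<^sup>2 \<ge> ?t\<^sup>2
      - r * (2 * \<epsilon> * ?t * ?s + r * (1 + ?s\<^sup>2) + 2 * ?t * ?s)"
    using main by (simp add: algebra_simps power2_eq_square)
  ultimately show ?thesis
    using x unfolding p_def by blast
qed

lemma sequence_if_orthogonal:
  fixes T S :: "'a::complex_inner \<Rightarrow> 'a"
  assumes unit: "\<exists>x::'a. norm x = 1"
    and T: "bounded_clinear T" and S: "bounded_clinear S"
    and orth: "approx_numerical_radius_orthogonal \<epsilon> T S"
  shows "\<exists>x :: nat \<Rightarrow> 'a.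
    (\<forall>n. norm (x n) = 1) \<and>
    (\<lambda>n. cmod (cinner (T (x n)) (x n))) \<longlonglongrightarrow> numerical_radius T \<and>
    (\<exists>l. (\<lambda>n. Re (exp (- (\<i> * complex_of_real \<theta>)) * cinner (T (x n)) (x n)
                 * cnj (cinner (S (x n)) (x n)))) \<longlonglongrightarrow> l \<and>
         l \<ge> - \<epsilon> * numerical_radius T * numerical_radius S)"
proof -
  let ?t = "numerical_radius T" and ?s = "numerical_radius S"
  let ?a = "\<lambda>x. cinner (T x) x" and ?b = "\<lambda>x. cinner (S x) x"
  let ?re = "\<lambda>x. Re (exp (- (\<i> * complex_of_real \<theta>)) * ?a x * cnj (?b x))"
  define r :: "nat \<Rightarrow> real" where "r n = inverse (real (Suc n))" for n
  have r_pos: "r n > 0" for n by (simp add: r_def)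
  have r_lim: "r \<longlonglongrightarrow> 0"
    unfolding r_def by (rule LIMSEQ_inverse_real_of_nat)
  have "\<forall>n. \<exists>x. norm x = 1
      \<and> ?re x \<ge> - \<epsilon> * ?t * ?s - r n * (1 + ?s\<^sup>2) / 2
      \<and> (cmod (?a x))\<^sup>2 \<ge> ?t\<^sup>2 - r n * (2 * \<epsilon> * ?t * ?s + r n * (1 + ?s\<^sup>2) + 2 * ?t * ?s)"
    using near_maximizer[OF unit T S orth r_pos] by blast
  then obtain x where x: "\<And>n. norm (x n) = 1"
    and re_ge: "\<And>n. ?re (x n) \<ge> - \<epsilon> * ?t * ?s - r n * (1 + ?s\<^sup>2) / 2"
    and a_ge: "\<And>n. (cmod (?a (x n)))\<^sup>2
        \<ge> ?t\<^sup>2 - r n * (2 * \<epsilon> * ?t * ?s + r n * (1 + ?s\<^sup>2) + 2 * ?t * ?s)"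
    by metis
  have a_le: "cmod (?a (x n)) \<le> ?t" and b_le: "cmod (?b (x n)) \<le> ?s" for n
    using cmod_cinner_le_numerical_radius T S x by blast+

  have "(\<lambda>n. (cmod (?a (x n)))\<^sup>2) \<longlonglongrightarrow> ?t\<^sup>2"
  proof (rule tendsto_sandwich[where h = "\<lambda>_. ?t\<^sup>2"])
    have "(\<lambda>n. ?t\<^sup>2 - r n * (2 * \<epsilon> * ?t * ?s + r n * (1 + ?s\<^sup>2) + 2 * ?t * ?s))
        \<longlonglongrightarrow> ?t\<^sup>2 - 0 * (2 * \<epsilon> * ?t * ?s + 0 * (1 + ?s\<^sup>2) + 2 * ?t * ?s)"
      by (intro tendsto_intros r_lim)
    then show "(\<lambda>n. ?t\<^sup>2 - r n * (2 * \<epsilon> * ?t * ?s + r n * (1 + ?s\<^sup>2) + 2 * ?t * ?s)) \<longlonglongrightarrow> ?t\<^sup>2"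
      by simp
  qed (use a_ge a_le in \<open>auto intro!: always_eventually power_mono\<close>)
  then have "(\<lambda>n. sqrt ((cmod (?a (x n)))\<^sup>2)) \<longlonglongrightarrow> sqrt (?t\<^sup>2)"
    by (rule tendsto_real_sqrt)
  then have a_lim: "(\<lambda>n. cmod (?a (x n))) \<longlonglongrightarrow> ?t"
    using numerical_radius_nonneg[OF unit T] by simp

  have "\<bar>?re (x n)\<bar> \<le> ?t * ?s" for n
  proof -
    have "\<bar>?re (x n)\<bar> \<le> cmod (?a (x n)) * cmod (?b (x n))"
      using abs_Re_le_cmod[of "exp (- (\<i> * complex_of_real \<theta>)) * ?a (x n) * cnj (?b (x n))"]
      by (simp add: norm_mult)
    also have "\<dots> \<le> ?t * ?s"
      using a_le b_le numerical_radius_nonneg[OF unit T] by (intro mult_mono) auto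
    finally show ?thesis .
  qed
  then have "bounded (range (\<lambda>n. ?re (x n)))"
    unfolding bounded_iff by auto
  then obtain l f where f: "strict_mono (f :: nat \<Rightarrow> nat)"
    and l: "((\<lambda>n. ?re (x n)) \<circ> f) \<longlonglongrightarrow> l"
    using bounded_imp_convergent_subsequence by blast

  have "(\<lambda>n. - \<epsilon> * ?t * ?s - (r \<circ> f) n * (1 + ?s\<^sup>2) / 2) \<longlonglongrightarrow> - \<epsilon> * ?t * ?s - 0 * (1 + ?s\<^sup>2) / 2"
    by (intro tendsto_intros LIMSEQ_subseq_LIMSEQ[OF r_lim f]) simp
  then have "- \<epsilon> * ?t * ?s - 0 * (1 + ?s\<^sup>2) / 2 \<le> l"
    by (rule LIMSEQ_le[OF _ l]) (use re_ge in auto)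
  moreover have "(\<lambda>n. cmod (?a (x (f n)))) \<longlonglongrightarrow> ?t"
    using LIMSEQ_subseq_LIMSEQ[OF a_lim f] by (simp add: o_def)
  ultimately show ?thesis
    using x l by (intro exI[of _ "x \<circ> f"] conjI exI[of _ l]) (auto simp: o_def)
qed

theorem theorem2p6:
  fixes T S :: "'a::complex_hilbert_space \<Rightarrow> 'a"
    and \<epsilon> :: real
  assumes "\<exists>x::'a. x \<noteq> 0"
    and "bounded_clinear T"
    and "bounded_clinear S"
    and "0 \<le> \<epsilon>" and "\<epsilon> < 1"
  shows "approx_numerical_radius_orthogonal \<epsilon> T S \<longleftrightarrow>
    (\<forall>\<theta>::real. 0 \<le> \<theta> \<and> \<theta> < 2 * pi \<longrightarrow>
      (\<exists>x :: nat \<Rightarrow> 'a.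
        (\<forall>n. norm (x n) = 1) \<and>
        (\<lambda>n. cmod (cinner (T (x n)) (x n))) \<longlonglongrightarrow> numerical_radius T \<and>
        (\<exists>l::real.
          (\<lambda>n. Re (exp (- (\<i> * complex_of_real \<theta>)) * cinner (T (x n)) (x n)
                     * cnj (cinner (S (x n)) (x n)))) \<longlonglongrightarrow> l \<and>
          l \<ge> - \<epsilon> * numerical_radius T * numerical_radius S)))"
proof (intro iffI allI impI)
  fix \<theta> :: real
  assume "approx_numerical_radius_orthogonal \<epsilon> T S"
  then show "\<exists>x :: nat \<Rightarrow> 'a.
        (\<forall>n. norm (x n) = 1) \<and>
        (\<lambda>n. cmod (cinner (T (x n)) (x n))) \<longlonglongrightarrow> numerical_radius T \<and>
        (\<exists>l::real.
          (\<lambda>n. Re (exp (- (\<i> * complex_of_real \<theta>)) * cinner (T (x n)) (x n)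
                     * cnj (cinner (S (x n)) (x n)))) \<longlonglongrightarrow> l \<and>
          l \<ge> - \<epsilon> * numerical_radius T * numerical_radius S)"
    by (rule sequence_if_orthogonal[OF ex_unit_vector[OF assms(1)] assms(2,3)])
next
  assume seqs: "\<forall>\<theta>::real. 0 \<le> \<theta> \<and> \<theta> < 2 * pi \<longrightarrow>
      (\<exists>x :: nat \<Rightarrow> 'a.
        (\<forall>n. norm (x n) = 1) \<and>
        (\<lambda>n. cmod (cinner (T (x n)) (x n))) \<longlonglongrightarrow> numerical_radius T \<and>
        (\<exists>l::real.
          (\<lambda>n. Re (exp (- (\<i> * complex_of_real \<theta>)) * cinner (T (x n)) (x n)
                     * cnj (cinner (S (x n)) (x n)))) \<longlonglongrightarrow> l \<and>
          l \<ge> - \<epsilon> * numerical_radius T * numerical_radius S))"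
  show "approx_numerical_radius_orthogonal \<epsilon> T S"
    unfolding approx_numerical_radius_orthogonal_def
  proof
    fix c :: complex
    let ?t = "numerical_radius T" and ?s = "numerical_radius S"
    have c: "complex_of_real (cmod c) * exp (\<i> * complex_of_real (Arg2pi c)) = c"
      using Arg2pi[of c] by (simp add: is_Arg_def)
    obtain x l where x: "\<And>n. norm (x n) = 1"
      and lim_T: "(\<lambda>n. cmod (cinner (T (x n)) (x n))) \<longlonglongrightarrow> ?t"
      and lim_l: "(\<lambda>n. Re (exp (- (\<i> * complex_of_real (Arg2pi c))) * cinner (T (x n)) (x n)
                     * cnj (cinner (S (x n)) (x n)))) \<longlonglongrightarrow> l"
      and l: "l \<ge> - \<epsilon> * ?t * ?s"
      using seqs Arg2pi_ge_0[of c] Arg2pi_lt_2pi[of c] by blast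
    have "?t\<^sup>2 - 2 * \<epsilon> * ?t * numerical_radius (\<lambda>x. c *\<^sub>C S x)
        = ?t\<^sup>2 + 2 * (cmod c * (- \<epsilon> * ?t * ?s))"
      using numerical_radius_scaleC[OF ex_unit_vector[OF assms(1)] assms(3), of c] by simp
    also have "\<dots> \<le> ?t\<^sup>2 + 2 * cmod c * l"
      using mult_left_mono[OF l, of "cmod c"] by (simp add: mult_ac)
    also have "\<dots> \<le> (numerical_radius (\<lambda>x. T x + c *\<^sub>C S x))\<^sup>2"
      using numerical_radius_sq_ge_limit[OF assms(2,3) x lim_T lim_l, of "cmod c"]
      by (simp only: c)
    finally show "?t\<^sup>2 - 2 * \<epsilon> * ?t * numerical_radius (\<lambda>x. c *\<^sub>C S x)
        \<le> (numerical_radius (\<lambda>x. T x + c *\<^sub>C S x))\<^sup>2" .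
  qed
qed

end
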